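(* Suppose $u=u_1\cdots u_n$ and $v=v_1\cdots v_n$ in $\mathbb{P}^*$ satisfy $u\sim_s v$. Then for any $k\in\mathbb{P}$, $u_1^k u_2^k\cdots u_n^k\sim_s v_1^k v_2^k\cdots v_n^k$, where $b^k$ denotes the word consisting of $k$ copies of $b$.
   Context: $\mathbb{P}$ is the positive integers; $\mathbb{P}^*$ the finite words over $\mathbb{P}$. Generalized factor order: $u\le w$ iff there is a factor $w'$ of $w$ (consecutive letters) with $|w'|=|u|$ and $u_i\le w'_i$ for all $i$; if $w'$ starts at the $j$th letter of $w$, $j$ is an embedding index, and $\mathrm{Em}(u,w)$ is the set of these. The weight of $w=w_1\cdots w_\ell$ is $t^\ell x^{w_1+\cdots+w_\ell}$. $u\sim_s v$ (strong Wilf equivalence) means there is a weight-preserving bijection $f:\mathbb{P}^*\to\mathbb{P}^*$ with $\mathrm{Em}(u,w)=\mathrm{Em}(v,f(w))$ for all $w$. *)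

theory Defs
  imports "HOL-Computational_Algebra.Polynomial"
begin

(* Positive integers are natural numbers greater than 0; words are lists of them. *)

definition pos_words :: "nat list set" where
  "pos_words = lists {0<..}"

(* Monomial t^(length) x^(sum of letters): the outer polynomial variable is t, the inner one x. *)

definition weight :: "nat list \<Rightarrow> int poly poly" where
  "weight w = monom (monom 1 (sum_list w)) (length w)"

(* Embedding indices are 1-based. *)

definition Em :: "nat list \<Rightarrow> nat list \<Rightarrow> nat set" where
  "Em u w = {length p + 1 | p w' s. w = p @ w' @ s \<and> list_all2 (\<le>) u w'}"

definition strongly_Wilf_equivalent :: "nat list \<Rightarrow> nat list \<Rightarrow> bool"  (infix "\<sim>\<^sub>s" 50) where
  "u \<sim>\<^sub>s v \<longleftrightarrow>
     (\<exists>f. bij_betw f pos_words pos_words \<and>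
          (\<forall>w\<in>pos_words. weight (f w) = weight w \<and> Em u w = Em v (f w)))"

definition repeat_letters :: "nat \<Rightarrow> nat list \<Rightarrow> nat list" where
  "repeat_letters k u = concat (map (replicate k) u)"

end

theory Submission
  imports Defs
begin

(* By inclusion-exclusion, u ~ v means that for each set S of positions equally many words of each
   weight embed u (respectively v) at least at all positions in S. The words embedding u at S are
   those that dominate a least word letter by letter, so their number depends only on the length
   and the sum of that least word. Hence u ~ v holds iff the least words of u and v have equal sums
   for all S. For the repeated words, splitting the positions by their residue modulo k writes the
   least word for S as an interleaving of k least words of the original word, so the condition is
   inherited. *)

section \<open>Bijections from equal fiber counts, and inclusion-exclusion\<close>

lemma bij_betw_if_card_fibers_eq:
  assumes fin: "\<And>c. finite {a \<in> A. g a = c}" "\<And>c. finite {b \<in> B. h b = c}"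
    and card_eq: "\<And>c. card {a \<in> A. g a = c} = card {b \<in> B. h b = c}"
  obtains f where "bij_betw f A B" "\<And>a. a \<in> A \<Longrightarrow> h (f a) = g a"
proof -
  have "\<exists>F. bij_betw F {a \<in> A. g a = c} {b \<in> B. h b = c}" for c
    using finite_same_card_bij[OF fin card_eq] .
  then obtain F where F: "\<And>c. bij_betw (F c) {a \<in> A. g a = c} {b \<in> B. h b = c}"
    by metis
  define f where "f a = F (g a) a" for a
  have f: "f a \<in> B \<and> h (f a) = g a" if "a \<in> A" for a
    using bij_betw_apply[OF F[of "g a"], of a] that by (simp add: f_def)
  \<comment> \<open>The fiberwise bijections glue because \<open>h (f a) = g a\<close>: the image of
    \<open>a\<close> reveals which fiber \<open>a\<close> came from.\<close>
  have "inj_on f A"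
  proof (rule inj_onI)
    fix a a' assume a: "a \<in> A" "a' \<in> A" "f a = f a'"
    then have "g a = g a'" using f by metis
    then show "a = a'"
      using bij_betw_imp_inj_on[OF F[of "g a"]] a by (auto simp: f_def inj_on_def)
  qed
  moreover have "b \<in> f ` A" if "b \<in> B" for b
  proof -
    have "b \<in> F (h b) ` {a \<in> A. g a = h b}"
      using bij_betw_imp_surj_on[OF F[of "h b"]] that by simp
    then show ?thesis by (auto simp: f_def intro!: image_eqI)
  qed
  ultimately have "bij_betw f A B"
    using f by (auto simp: bij_betw_def)
  then show thesis using f that by blast
qed

lemma card_supersets_eq:
  assumes "finite X" "finite A" "\<And>a. a \<in> A \<Longrightarrow> g a \<subseteq> X" "S \<subseteq> X"
  shows "card {a \<in> A. S \<subseteq> g a}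
    = card {a \<in> A. g a = S} + (\<Sum>T\<in>{T. S \<subseteq> T \<and> T \<subseteq> X} - {S}. card {a \<in> A. g a = T})"
proof -
  define I where "I = {T. S \<subseteq> T \<and> T \<subseteq> X}"
  have I: "finite I" "S \<in> I"
    using assms by (auto simp: I_def)
  have "{a \<in> A. S \<subseteq> g a} = (\<Union>T\<in>I. {a \<in> A. g a = T})"
    using assms by (auto simp: I_def)
  moreover have "card (\<Union>T\<in>I. {a \<in> A. g a = T}) = (\<Sum>T\<in>I. card {a \<in> A. g a = T})"
    by (rule card_UN_disjoint) (use assms I in auto)
  ultimately show ?thesis
    using sum.remove[OF I, of "\<lambda>T. card {a \<in> A. g a = T}"] by (simp flip: I_def)
qed

text \<open>Inclusion-exclusion without signs: by downward induction from \<open>S = X\<close>, the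
  counts for all strictly larger sets already agree, and subtracting them from the two equal
  superset counts leaves the counts for \<open>S\<close> itself.\<close>

lemma card_fibers_eq_if_card_supersets_eq:
  assumes fin: "finite X" "finite A" "finite B"
    and sub: "\<And>a. a \<in> A \<Longrightarrow> g a \<subseteq> X" "\<And>b. b \<in> B \<Longrightarrow> h b \<subseteq> X"
    and card_eq: "\<And>S. S \<subseteq> X \<Longrightarrow> card {a \<in> A. S \<subseteq> g a} = card {b \<in> B. S \<subseteq> h b}"
  shows "card {a \<in> A. g a = S} = card {b \<in> B. h b = S}"
proof (cases "S \<subseteq> X")
  case False
  then have "{a \<in> A. g a = S} = {}" "{b \<in> B. h b = S} = {}" using sub by auto
  then show ?thesis by (simp only: card.empty)
next
  case True
  then show ?thesis
  proof (induction "card (X - S)" arbitrary: S rule: less_induct)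
    case less
    define I where "I = {T. S \<subseteq> T \<and> T \<subseteq> X}"
    have "(\<Sum>T\<in>I - {S}. card {a \<in> A. g a = T}) = (\<Sum>T\<in>I - {S}. card {b \<in> B. h b = T})"
    proof (rule sum.cong[OF refl])
      fix T assume T: "T \<in> I - {S}"
      then have "X - T \<subset> X - S" by (auto simp: I_def)
      then have "card (X - T) < card (X - S)" using fin(1) by (simp add: psubset_card_mono)
      then show "card {a \<in> A. g a = T} = card {b \<in> B. h b = T}"
        using less.hyps T by (auto simp: I_def)
    qed
    then show ?case
      using card_eq[OF less.prems] card_supersets_eq[of X A g S] card_supersets_eq[of X B h S]
        fin sub less.prems by (simp add: I_def)
  qed
qed

section \<open>Sums split by residues, and counts of dominating words\<close>

lemma sum_by_residues:
  fixes g :: "nat \<Rightarrow> 'a::comm_monoid_add"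
  assumes "k > 0"
  shows "(\<Sum>i<L. g i) = (\<Sum>r<k. \<Sum>q<(L + (k - 1) - r) div k. g (k * q + r))"
proof -
  \<comment> \<open>The quotient is the ceiling of (L - r) / k, the number of indices below
    \<open>L\<close> with residue \<open>r\<close>. Since \<open>r < k\<close>, the subtraction does
    not truncate.\<close>
  have bound: "q < (L + (k - 1) - r) div k \<longleftrightarrow> k * q + r < L" if "r < k" for q r
  proof -
    have "q < (L + (k - 1) - r) div k \<longleftrightarrow> Suc q * k \<le> L + (k - 1) - r"
      using assms by (simp add: less_eq_div_iff_mult_less_eq flip: Suc_le_eq)
    then show ?thesis using that by (auto simp: algebra_simps)
  qed
  have "(\<Sum>i<L. g i) = (\<Sum>(r, q)\<in>(SIGMA r:{..<k}. {..<(L + (k - 1) - r) div k}). g (k * q + r))"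
    by (rule sum.reindex_bij_witness[of _ "\<lambda>(r, q). k * q + r" "\<lambda>i. (i mod k, i div k)"])
       (use assms bound in auto)
  also have "\<dots> = (\<Sum>r<k. \<Sum>q<(L + (k - 1) - r) div k. g (k * q + r))"
    by (rule sum.Sigma[symmetric]) auto
  finally show ?thesis .
qed

text \<open>The translation \<open>w - b + c\<close> takes words above \<open>b\<close> to words
  above \<open>c\<close>, with inverse \<open>w - c + b\<close>. It keeps the sum because
  \<open>b\<close> and \<open>c\<close> have the same sum; domination makes every natural
  subtraction exact.\<close>

lemma card_dominating_lists_eq:
  fixes b c :: "nat list"
  assumes "length b = length c" "sum_list b = sum_list c"
  shows "card {w. list_all2 (\<le>) b w \<and> sum_list w = m} = card {w. list_all2 (\<le>) c w \<and> sum_list w = m}"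
proof -
  define T where "T p q w = map (\<lambda>i. w ! i - p ! i + q ! i) [0..<length w]" for p q w :: "nat list"
  have mem: "list_all2 (\<le>) q (T p q w) \<and> sum_list (T p q w) = sum_list w"
    if "list_all2 (\<le>) p w" "length p = length q" "sum_list p = sum_list q" for p q w
  proof -
    have le: "p ! i \<le> w ! i" if "i < length w" for i
      using \<open>list_all2 (\<le>) p w\<close> that by (auto simp: list_all2_conv_all_nth)
    have len: "length w = length p"
      using that(1) by (simp add: list_all2_lengthD)
    have "sum_list (T p q w) = (\<Sum>i<length w. w ! i - p ! i + q ! i)"
      by (simp add: T_def interv_sum_list_conv_sum_set_nat lessThan_atLeast0)
    also have "\<dots> = (\<Sum>i<length w. w ! i) - (\<Sum>i<length w. p ! i) + (\<Sum>i<length w. q ! i)"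
      unfolding sum.distrib using le by (subst sum_subtractf_nat) auto
    also have "\<dots> = sum_list w"
      using that len sum_mono[of "{..<length w}" "\<lambda>i. p ! i" "\<lambda>i. w ! i"] le
      by (simp add: sum_list_sum_nth lessThan_atLeast0)
    finally show ?thesis
      using len that(2) by (simp add: T_def list_all2_conv_all_nth)
  qed
  have inv: "T q p (T p q w) = w" if "list_all2 (\<le>) p w" for p q w
    using that by (auto simp: T_def list_all2_conv_all_nth intro!: nth_equalityI)
  have "bij_betw (T b c) {w. list_all2 (\<le>) b w \<and> sum_list w = m} {w. list_all2 (\<le>) c w \<and> sum_list w = m}"
    by (rule bij_betw_byWitness[where f' = "T c b"]) (use mem inv assms in auto)
  then show ?thesis by (rule bij_betw_same_card)
qed

section \<open>Weights, embeddings and least words in terms of indices\<close>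

lemma weight_eq_iff: "weight w = weight w' \<longleftrightarrow> length w = length w' \<and> sum_list w = sum_list w'"
  by (auto simp: weight_def monom_eq_iff')

lemma in_pos_words_iff: "w \<in> pos_words \<longleftrightarrow> (\<forall>i<length w. w ! i > 0)"
  by (auto simp: pos_words_def in_lists_conv_set all_set_conv_all_nth)

lemma finite_pos_words_length_sum: "finite {w \<in> pos_words. length w = l \<and> sum_list w = m}"
proof (rule finite_subset)
  show "{w \<in> pos_words. length w = l \<and> sum_list w = m} \<subseteq> {w. set w \<subseteq> {..m} \<and> length w = l}"
    using member_le_sum_list by auto
qed (simp add: finite_lists_length_eq)

text \<open>Zero-based counterpart of \<open>Em\<close>, phrased by indices so that the demands of
  several overlapping copies of \<open>u\<close> can be compared letter by letter.\<close>

definition embeddings :: "nat list \<Rightarrow> nat list \<Rightarrow> nat set" where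
  "embeddings u w = {j. j + length u \<le> length w \<and> (\<forall>i<length u. u ! i \<le> w ! (j + i))}"

lemma Em_eq: "Em u w = Suc ` embeddings u w"
proof -
  have "j \<in> embeddings u w \<longleftrightarrow> (\<exists>p w' s. j = length p \<and> w = p @ w' @ s \<and> list_all2 (\<le>) u w')" for j
  proof
    assume "j \<in> embeddings u w"
    then show "\<exists>p w' s. j = length p \<and> w = p @ w' @ s \<and> list_all2 (\<le>) u w'"
      by (intro exI[of _ "take j w"] exI[of _ "take (length u) (drop j w)"]
           exI[of _ "drop (length u) (drop j w)"])
         (auto simp: embeddings_def list_all2_conv_all_nth simp del: drop_drop)
  next
    assume "\<exists>p w' s. j = length p \<and> w = p @ w' @ s \<and> list_all2 (\<le>) u w'"
    then show "j \<in> embeddings u w"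
      by (auto simp: embeddings_def list_all2_conv_all_nth nth_append)
  qed
  then have "embeddings u w = {length p | p w' s. w = p @ w' @ s \<and> list_all2 (\<le>) u w'}"
    by blast
  then show ?thesis by (auto simp: Em_def)
qed

lemma Em_eq_iff: "Em u w = Em v w' \<longleftrightarrow> embeddings u w = embeddings v w'"
  by (simp add: Em_eq inj_image_eq_iff)

text \<open>A copy of \<open>u\<close> starting at \<open>j\<close> demands
  \<open>u ! (i - j)\<close> at each position \<open>i\<close> that it covers; the largest demand of
  the copies starting in \<open>S\<close> wins. The inserted 1 keeps the letter positive where no
  copy reaches, and keeps the \<open>Max\<close> over a nonempty set.\<close>

definition least_letter :: "nat list \<Rightarrow> nat set \<Rightarrow> nat \<Rightarrow> nat" where
  "least_letter u S i = Max (insert 1 ((\<lambda>j. u ! (i - j)) ` {j \<in> S. j \<le> i \<and> i < j + length u}))"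

definition least_word :: "nat list \<Rightarrow> nat set \<Rightarrow> nat \<Rightarrow> nat list" where
  "least_word u S l = map (least_letter u S) [0..<l]"

lemma length_least_word [simp]: "length (least_word u S l) = l"
  by (simp add: least_word_def)

lemma sum_list_least_word: "sum_list (least_word u S l) = (\<Sum>i<l. least_letter u S i)"
  by (simp add: least_word_def interv_sum_list_conv_sum_set_nat lessThan_atLeast0)

lemma least_letter_le_iff:
  "least_letter u S i \<le> m \<longleftrightarrow> 1 \<le> m \<and> (\<forall>j\<in>S. j \<le> i \<and> i < j + length u \<longrightarrow> u ! (i - j) \<le> m)"
proof -
  have "finite {j \<in> S. j \<le> i \<and> i < j + length u}"
    by (rule finite_subset[of _ "{..i}"]) auto
  then show ?thesis by (auto simp: least_letter_def)
qed

text \<open>The bound on \<open>S\<close> makes each copy end within length \<open>l\<close>, so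
  each of its demands falls on a position that the least word has.\<close>

lemma dominates_least_word_iff:
  assumes S: "S \<subseteq> {j. j + length u \<le> l}"
  shows "list_all2 (\<le>) (least_word u S l) w \<longleftrightarrow> w \<in> pos_words \<and> length w = l \<and> S \<subseteq> embeddings u w"
    (is "?L \<longleftrightarrow> ?R")
proof
  assume ?L
  then have len: "length w = l" and
    le: "\<And>i. i < l \<Longrightarrow> 1 \<le> w ! i \<and> (\<forall>j\<in>S. j \<le> i \<and> i < j + length u \<longrightarrow> u ! (i - j) \<le> w ! i)"
    by (auto simp: list_all2_conv_all_nth least_word_def least_letter_le_iff)
  have "u ! i \<le> w ! (j + i)" if "j \<in> S" "i < length u" for i j
    using S le[of "j + i"] that by force
  then show ?R
    using S len le by (force simp: embeddings_def in_pos_words_iff)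
next
  assume R: ?R
  have "u ! (i - j) \<le> w ! i" if "j \<in> S" "j \<le> i" "i < j + length u" for i j
  proof -
    have "i - j < length u" "j \<in> embeddings u w" using that R by auto
    then have "u ! (i - j) \<le> w ! (j + (i - j))" unfolding embeddings_def by blast
    then show ?thesis using that by simp
  qed
  then show ?L
    using R by (force simp: list_all2_conv_all_nth least_word_def least_letter_le_iff in_pos_words_iff)
qed

section \<open>The sum criterion for strong Wilf equivalence\<close>

lemma strongly_Wilf_equivalent_sym:
  assumes "u \<sim>\<^sub>s v"
  shows "v \<sim>\<^sub>s u"
proof -
  obtain f where f: "bij_betw f pos_words pos_words"
    "\<And>w. w \<in> pos_words \<Longrightarrow> weight (f w) = weight w \<and> Em u w = Em v (f w)"
    using assms by (auto simp: strongly_Wilf_equivalent_def)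
  define g where "g = inv_into pos_words f"
  have g: "bij_betw g pos_words pos_words"
    using f(1) by (simp add: g_def bij_betw_inv_into)
  moreover have "weight (g w) = weight w \<and> Em v w = Em u (g w)" if "w \<in> pos_words" for w
    using f(2)[of "g w"] bij_betw_inv_into_right[OF f(1) that] bij_betw_apply[OF g that]
    by (simp add: g_def)
  ultimately show ?thesis by (auto simp: strongly_Wilf_equivalent_def)
qed

text \<open>The bijection sends the least word of \<open>v\<close> to a word of the same length and
  sum that embeds \<open>u\<close> at \<open>S\<close>, hence lies above the least word of
  \<open>u\<close>. Symmetry of the relation supplies the reverse inequality.\<close>

lemma sum_least_letter_le:
  assumes "v \<sim>\<^sub>s u" "length v = length u" and S: "S \<subseteq> {j. j + length u \<le> l}"
  shows "(\<Sum>i<l. least_letter u S i) \<le> (\<Sum>i<l. least_letter v S i)"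
proof -
  obtain f where f: "bij_betw f pos_words pos_words"
    "\<And>w. w \<in> pos_words \<Longrightarrow> weight (f w) = weight w \<and> Em v w = Em u (f w)"
    using assms(1) by (auto simp: strongly_Wilf_equivalent_def)
  let ?w = "least_word v S l"
  have "list_all2 (\<le>) ?w ?w" by (simp add: list_all2_refl)
  then have w: "?w \<in> pos_words" "S \<subseteq> embeddings v ?w"
    using dominates_least_word_iff[of S v l ?w] assms by auto
  have fw: "length (f ?w) = l" "sum_list (f ?w) = sum_list ?w" "S \<subseteq> embeddings u (f ?w)"
    using f(2)[OF w(1)] w(2) by (auto simp: weight_eq_iff Em_eq_iff)
  then have "list_all2 (\<le>) (least_word u S l) (f ?w)"
    using dominates_least_word_iff[OF S] bij_betw_apply[OF f(1) w(1)] by auto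
  then have "sum_list (least_word u S l) \<le> sum_list (f ?w)"
    by (auto simp: list_all2_conv_all_nth sum_list_sum_nth intro!: sum_mono)
  then show ?thesis using fw(2) by (simp add: sum_list_least_word)
qed

lemma strongly_Wilf_equivalent_iff:
  assumes len: "length u = length v"
  shows "u \<sim>\<^sub>s v \<longleftrightarrow> (\<forall>l S. S \<subseteq> {j. j + length u \<le> l} \<longrightarrow>
    (\<Sum>i<l. least_letter u S i) = (\<Sum>i<l. least_letter v S i))" (is "?L \<longleftrightarrow> ?R")
proof
  assume ?L
  then show ?R
    using strongly_Wilf_equivalent_sym sum_least_letter_le len by (metis order_antisym)
next
  assume R: ?R
  define C where "C l m = {w \<in> pos_words. length w = l \<and> sum_list w = m}" for l m
  \<comment> \<open>The key bundles weight and embedding set, so a bijection carrying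
    \<open>key u\<close> to \<open>key v\<close> is a witness of equivalence. Its fibers are finite
    because length and sum are fixed.\<close>
  define key where "key x w = (length w, sum_list w, embeddings x w)" for x w
  have fiber: "{w \<in> pos_words. key x w = (l, m, S)} = {w \<in> C l m. embeddings x w = S}" for x l m S
    by (auto simp: key_def C_def)
  have finC: "finite (C l m)" for l m
    using finite_pos_words_length_sum by (simp add: C_def)
  have "card {w \<in> C l m. embeddings u w = S} = card {w \<in> C l m. embeddings v w = S}" for l m S
  proof (rule card_fibers_eq_if_card_supersets_eq[where X = "{j. j + length u \<le> l}"])
    show "finite {j. j + length u \<le> l}" by (rule finite_subset[of _ "{..l}"]) auto
    fix S assume S: "S \<subseteq> {j. j + length u \<le> l}"
    have sup: "{w \<in> C l m. S \<subseteq> embeddings x w}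
        = {w. list_all2 (\<le>) (least_word x S l) w \<and> sum_list w = m}" if "length x = length u" for x
      using dominates_least_word_iff[of S x l] S that by (auto simp: C_def)
    show "card {w \<in> C l m. S \<subseteq> embeddings u w} = card {w \<in> C l m. S \<subseteq> embeddings v w}"
      using R S len by (auto simp: sup sum_list_least_word intro!: card_dominating_lists_eq)
  qed (use finC len in \<open>auto simp: C_def embeddings_def\<close>)
  then have card_key: "card {w \<in> pos_words. key u w = c} = card {w \<in> pos_words. key v w = c}" for c
    by (cases c) (simp add: fiber)
  have fin_key: "finite {w \<in> pos_words. key x w = c}" for x c
    by (cases c) (simp add: fiber finC)
  obtain f where "bij_betw f pos_words pos_words"
    "\<And>w. w \<in> pos_words \<Longrightarrow> key v (f w) = key u w"
    using bij_betw_if_card_fibers_eq[OF fin_key fin_key card_key] by blast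
  then show ?L
    by (auto simp: strongly_Wilf_equivalent_def weight_eq_iff Em_eq_iff key_def)
qed

section \<open>Least words of words with repeated letters\<close>

lemma length_repeat_letters [simp]: "length (repeat_letters k u) = k * length u"
  by (induction u) (simp_all add: repeat_letters_def)

lemma nth_repeat_letters:
  "i < k * length u \<Longrightarrow> repeat_letters k u ! i = u ! (i div k)"
proof (induction u arbitrary: i)
  case (Cons a u)
  then have "k > 0" by (cases k) auto
  show ?case
  proof (cases "i < k")
    case False
    then have "i div k = Suc ((i - k) div k)"
      using \<open>k > 0\<close> by (simp add: le_div_geq)
    then show ?thesis
      using False Cons.IH[of "i - k"] Cons.prems by (simp add: repeat_letters_def nth_append)
  qed (simp add: repeat_letters_def nth_append)
qed simp

(* (j + (k - 1) - r) div k is the ceiling of (j - r) / k. *)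
lemma least_letter_repeat_letters:
  assumes r: "r < k"
  shows "least_letter (repeat_letters k u) S (k * q + r)
    = least_letter u ((\<lambda>j. (j + (k - 1) - r) div k) ` S) q"
proof -
  define c where "c j = (j + (k - 1) - r) div k" for j
  have c: "j \<le> k * c j + r" "k * c j + r < j + k" for j
  proof -
    have "k * c j + (j + (k - 1) - r) mod k = j + (k - 1) - r"
      by (simp add: c_def)
    moreover have "(j + (k - 1) - r) mod k < k" using r by simp
    ultimately show "j \<le> k * c j + r" "k * c j + r < j + k" using r by linarith+
  qed
  \<comment> \<open>So \<open>c j\<close> is the least \<open>q\<close> whose position
    \<open>k * q + r\<close> is not before \<open>j\<close>: it is where a copy starting at
    \<open>j\<close> first meets the residue class of \<open>r\<close>.\<close>
  have c_le: "j \<le> k * q + r \<longleftrightarrow> c j \<le> q" for j q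
  proof
    assume "j \<le> k * q + r"
    then have "k * c j < k * Suc q" using c(2)[of j] by simp
    then show "c j \<le> q" by (simp only: mult_less_cancel1 less_Suc_eq_le)
  next
    assume "c j \<le> q"
    then have "k * c j \<le> k * q" by simp
    then show "j \<le> k * q + r" using c(1)[of j] by linarith
  qed
  have c_add: "c (j + k * n) = c j + n" for j n
  proof -
    have "j + k * n + (k - 1) - r = j + (k - 1) - r + k * n" using r by simp
    moreover have "(m + k * n) div k = m div k + n" for m
      using r by simp
    ultimately show ?thesis by (simp only: c_def)
  qed
  \<comment> \<open>The end of a copy is handled like its start: moving \<open>j\<close> by
    \<open>k * length u\<close> moves \<open>c j\<close> by \<open>length u\<close>. Thus the copy
    at \<open>j\<close> covers \<open>k * q + r\<close> exactly if a copy of \<open>u\<close> at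
    \<open>c j\<close> covers \<open>q\<close>.\<close>
  have range: "k * q + r < j + k * length u \<longleftrightarrow> q < c j + length u" for j
    using c_le[of "j + k * length u" q] c_add[of j "length u"] by (metis not_le)
  have quot: "(k * q + r - j) div k = q - c j" if "c j \<le> q" for j
  proof -
    \<comment> \<open>The offset \<open>k * c j + r - j\<close> of the first meeting point is below
      \<open>k\<close>, so it vanishes in the quotient and the letter read is
      \<open>u ! (q - c j)\<close>.\<close>
    have "k * q + r - j = k * (q - c j) + (k * c j + r - j)"
      using that c(1)[of j] mult_le_mono2[OF that, of k] by (simp add: diff_mult_distrib2)
    moreover have "k * c j + r - j < k" using c(1,2)[of j] by linarith
    ultimately show ?thesis by simp
  qed
  have nth: "repeat_letters k u ! (k * q + r - j) = u ! (q - c j)"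
    if "c j \<le> q" "q < c j + length u" for j
  proof -
    have "k * q + r - j < k * length u" using that c_le[of j q] range[of j] by linarith
    then show ?thesis using nth_repeat_letters quot that by simp
  qed
  have "(\<lambda>j. repeat_letters k u ! (k * q + r - j)) ` {j \<in> S. c j \<le> q \<and> q < c j + length u}
      = (\<lambda>j. u ! (q - j)) ` {j \<in> c ` S. j \<le> q \<and> q < j + length u}"
    using nth by (force simp: image_iff)
  then show ?thesis
    unfolding c_def[symmetric] by (simp add: least_letter_def c_le range)
qed

theorem theorem5p3:
  fixes u v :: "nat list" and n k :: nat
  assumes "u \<in> pos_words" and "v \<in> pos_words"
    and "length u = n" and "length v = n"
    and "u \<sim>\<^sub>s v"
    and "k > 0"
  shows "repeat_letters k u \<sim>\<^sub>s repeat_letters k v"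
proof -
  have eq: "(\<Sum>i<l. least_letter u S i) = (\<Sum>i<l. least_letter v S i)"
    if "S \<subseteq> {j. j + n \<le> l}" for l S
    using strongly_Wilf_equivalent_iff[of u v] assms that by simp
  have "(\<Sum>i<L. least_letter (repeat_letters k u) S i) = (\<Sum>i<L. least_letter (repeat_letters k v) S i)"
    if S: "S \<subseteq> {j. j + k * n \<le> L}" for L S
    unfolding sum_by_residues[OF \<open>k > 0\<close>, of _ L]
  proof (rule sum.cong[OF refl])
    fix r assume "r \<in> {..<k}"
    then have r: "r < k" by simp
    \<comment> \<open>The criterion for \<open>u\<close> and \<open>v\<close> requires that the
      rescaled copies still fit: this is \<open>j + k * n \<le> L\<close> after the monotone map to
      ceilings, which turns \<open>k * n\<close> into \<open>n\<close>.\<close>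
    have "(j + (k - 1) - r) div k + n \<le> (L + (k - 1) - r) div k" if "j \<in> S" for j
    proof -
      have "(j + (k - 1) - r) div k + n = (j + (k - 1) - r + k * n) div k"
        using \<open>k > 0\<close> by simp
      also have "\<dots> \<le> (L + (k - 1) - r) div k"
        using S that r by (intro div_le_mono) auto
      finally show ?thesis .
    qed
    then show "(\<Sum>q<(L + (k - 1) - r) div k. least_letter (repeat_letters k u) S (k * q + r))
        = (\<Sum>q<(L + (k - 1) - r) div k. least_letter (repeat_letters k v) S (k * q + r))"
      unfolding least_letter_repeat_letters[OF r] by (intro eq) auto
  qed
  then show ?thesis
    using strongly_Wilf_equivalent_iff[of "repeat_letters k u" "repeat_letters k v"] assms by simp
qed

end
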